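(* Let $N$ be a finite set of agents with $|N|\ge 3$ odd, and let $G$ be the cycle of length $1$. There exists a strategyproof (in expectation) mechanism $M: G^N\to\Delta(G)$ whose approximation ratio over all profiles is bounded from above by $7/4$, i.e. $\mathrm{sc}_b(M(b))\le \tfrac74\,\mathrm{opt}_b$ for every profile $b\in G^N$.
   Context: The cycle $G$ of length $1$ is obtained from the segment $[-0.5,0.5]$ by joining its endpoints (so $G$ is identified with $[-0.5,0.5)$), with metric $d(v_1,v_2)=\min(|v_2-v_1|,\,1-|v_2-v_1|)$. A profile is a function $b:N\to G$; $b_i$ is the ideal point of agent $i$. $\Delta(G)$ is the set of lotteries over $G$, i.e. discrete probability distributions on $G$, viewed as functions $l:G\to[0,1]$ whose values sum to $1$. The cost of a lottery $l$ to an agent with ideal point $v$ is $c_v(l)=\mathbb{E}_{X\sim l}[d(v,X)]$. The social cost of $l$ in profile $b$ is $\mathrm{sc}_b(l)=\sum_{i\in N}c_{b_i}(l)$; for a point $v\in G$, $\mathrm{sc}_b(v)$ is the social cost of the lottery selecting $v$ with probability $1$. The optimal cost is $\mathrm{opt}_b=\inf_{v\in G}\mathrm{sc}_b(v)$. A mechanism is a function from profiles to $\Delta(G)$. A mechanism $M$ is strategyproof (in expectation) if for every profile $b$, every agent $i\in N$ and every $v\in G$, $c_{b_i}(M(b))\le c_{b_i}(M(b[i\to v]))$, where $b[i\to v]$ is the profile equal to $b$ except that agent $i$ reports $v$. The approximation ratio of $M$ is the smallest $\alpha$ such that $\mathrm{sc}_b(M(b))\le\alpha\,\mathrm{opt}_b$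 for all profiles $b$. *)

theory Defs
  imports "HOL-Probability.Probability_Mass_Function"
begin

typedef cycle = "{-1/2..<1/2 :: real}"
  morphisms coord of_coord
  by (rule exI[of _ 0]) simp

definition cdist :: "cycle \<Rightarrow> cycle \<Rightarrow> real" where
  "cdist v w = min \<bar>coord w - coord v\<bar> (1 - \<bar>coord w - coord v\<bar>)"

text \<open>
  Profiles have type \<^typ>\<open>'n \<Rightarrow> cycle\<close>, the agents being the elements of a finite
  type \<^typ>\<open>'n\<close>. Since \<^const>\<open>cdist\<close> takes values in \<open>[0, 1/2]\<close>, the
  expectation below always exists.
\<close>

definition cost :: "cycle \<Rightarrow> cycle pmf \<Rightarrow> real" where
  "cost v l = measure_pmf.expectation l (\<lambda>x. cdist v x)"

definition social_cost :: "('n::finite \<Rightarrow> cycle) \<Rightarrow> cycle pmf \<Rightarrow> real" where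
  "social_cost b l = (\<Sum>i\<in>UNIV. cost (b i) l)"

definition opt_cost :: "('n::finite \<Rightarrow> cycle) \<Rightarrow> real" where
  "opt_cost b = (INF v. social_cost b (return_pmf v))"

definition strategyproof :: "(('n::finite \<Rightarrow> cycle) \<Rightarrow> cycle pmf) \<Rightarrow> bool" where
  "strategyproof M \<longleftrightarrow> (\<forall>b i v. cost (b i) (M b) \<le> cost (b i) (M (b(i := v))))"

end

theory Submission
  imports Defs
begin

text \<open>
  Let \<open>n = 2k + 1\<close>. The mechanism tosses a fair coin between a uniformly random dictator and the
  rule PCD (proportional circle distance): cut the circle at a uniformly random point and choose the
  median of the agents on the resulting line. If \<open>c\<close> is the sorted lift of the profile to the real
  line, with \<open>c (j + n) = c j + 1\<close>, PCD selects \<open>c j\<close> with probability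
  \<open>c (j + k + 1) - c (j + k)\<close>, the length of the arc opposite to it.

  Strategyproofness of PCD: let an agent at \<open>t\<close> report \<open>w\<close>, and let \<open>A\<close>, \<open>B\<close> be the ends of the arc
  opposite to \<open>w\<close>, of length \<open>p\<close>. Moving \<open>w\<close> away from \<open>t\<close> by \<open>\<epsilon>\<close> inside a gap between other agents
  increases \<open>d(t, w)\<close>, which has weight \<open>p\<close>, by \<open>\<epsilon>\<close>, and moves weight \<open>\<epsilon>\<close> from \<open>B\<close> to \<open>A\<close>, which
  gains at most \<open>\<epsilon> d(A, B) \<le> \<epsilon> p\<close>. So the cost does not decrease on the way from \<open>t\<close> to its antipode,
  in either direction.

  Ratio: an optimal location \<open>z\<close> is an agent and the median of the line cut at its antipode. Let
  \<open>X i\<close> and \<open>Y i\<close> be the distances from \<open>z\<close> of the \<open>i\<close>-th agents to its right and left. The excess of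
  PCD over the optimum \<open>\<Sum>(X i + Y i)\<close> is at most a bilinear form in \<open>X\<close> and \<open>Y\<close>, and the random
  dictator costs at most \<open>4/n \<Sum> i (X i + Y i)\<close>. Written in the increments of \<open>X\<close> and \<open>Y\<close>, whose
  sums are at most \<open>1/2\<close>, the inequality holds coefficient by coefficient.
\<close>

subsection \<open>The distance on the circle\<close>

text \<open>The distance to the nearest integer. Being total on the reals, it applies to lifted
  points before any reduction modulo \<open>1\<close>.\<close>

definition circ_norm :: "real \<Rightarrow> real" where
  "circ_norm x = min (frac x) (1 - frac x)"

lemma circ_norm_add_int [simp]: "circ_norm (x + of_int m) = circ_norm x"
  by (simp add: circ_norm_def frac_def)

lemma circ_norm_add_1 [simp]: "circ_norm (x + 1) = circ_norm x"
  using circ_norm_add_int[of x 1] by simp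

lemma circ_norm_nonneg [simp]: "circ_norm x \<ge> 0"
  using frac_lt_1[of x] by (simp add: circ_norm_def)

lemma circ_norm_le_abs: "circ_norm x \<le> \<bar>x\<bar>"
proof (cases "x \<ge> 0")
  case True
  then have "frac x \<le> x" by (simp add: frac_def)
  with True show ?thesis by (simp add: circ_norm_def)
next
  case False
  then have "\<lfloor>x\<rfloor> \<le> -1" by linarith
  then have "real_of_int \<lfloor>x\<rfloor> \<le> -1" by linarith
  with False have "1 - frac x \<le> - x" unfolding frac_def by linarith
  with False show ?thesis by (simp add: circ_norm_def)
qed

text \<open>Together with periodicity and \<open>circ_norm_le_abs\<close>, a nearest integer reduces
  the triangle inequality and symmetry to facts about absolute values.\<close>

lemma circ_norm_witness: "\<exists>m. circ_norm x = \<bar>x - of_int m\<bar>"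
proof (cases "frac x \<le> 1 - frac x")
  case True
  then have "circ_norm x = \<bar>x - of_int \<lfloor>x\<rfloor>\<bar>"
    by (simp add: circ_norm_def frac_def)
  then show ?thesis by blast
next
  case False
  then have "circ_norm x = \<bar>x - of_int (\<lfloor>x\<rfloor> + 1)\<bar>"
    using frac_lt_1[of x] by (simp add: circ_norm_def frac_def)
  then show ?thesis by blast
qed

lemma circ_norm_add_le: "circ_norm (x + y) \<le> circ_norm x + \<bar>y\<bar>"
proof -
  obtain m where m: "circ_norm x = \<bar>x - of_int m\<bar>" using circ_norm_witness by blast
  have "circ_norm (x + y) = circ_norm (x + y - of_int m)"
    using circ_norm_add_int[of "x + y - of_int m" m] by simp
  also have "\<dots> \<le> \<bar>x + y - of_int m\<bar>" by (rule circ_norm_le_abs)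
  also have "\<dots> \<le> circ_norm x + \<bar>y\<bar>" unfolding m by linarith
  finally show ?thesis .
qed

lemma circ_norm_lipschitz: "\<bar>circ_norm x - circ_norm y\<bar> \<le> \<bar>x - y\<bar>"
  using circ_norm_add_le[of x "y - x"] circ_norm_add_le[of y "x - y"] by simp

lemma circ_norm_uminus [simp]: "circ_norm (- x) = circ_norm x"
proof -
  have le: "circ_norm (- u) \<le> circ_norm u" for u
  proof -
    obtain m where m: "circ_norm u = \<bar>u - of_int m\<bar>" using circ_norm_witness by blast
    have "circ_norm (- u) = circ_norm (- u + of_int m)" by (rule circ_norm_add_int[symmetric])
    also have "\<dots> \<le> \<bar>- u + of_int m\<bar>" by (rule circ_norm_le_abs)
    finally show ?thesis using m by linarith
  qed
  show ?thesis using le[of x] le[of "- x"] by simp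
qed

lemma circ_norm_commute: "circ_norm (x - y) = circ_norm (y - x)"
  using circ_norm_uminus[of "x - y"] by simp

lemma circ_norm_small:
  assumes "0 \<le> x" "x < 1"
  shows "circ_norm x = min x (1 - x)"
  using assms by (simp add: circ_norm_def frac_eq[THEN iffD2])

lemma circ_norm_eq_abs:
  assumes "\<bar>x\<bar> \<le> 1/2"
  shows "circ_norm x = \<bar>x\<bar>"
  using assms circ_norm_small[of "\<bar>x\<bar>"] by (cases "x \<ge> 0") auto

lemma cdist_circ_norm: "cdist v w = circ_norm (coord w - coord v)"
proof -
  have "\<bar>coord w - coord v\<bar> < 1" using coord[of v] coord[of w] by auto
  then have "circ_norm \<bar>coord w - coord v\<bar> = cdist v w"
    by (simp add: circ_norm_small cdist_def)
  then show ?thesis by (cases "coord w \<ge> coord v") (auto simp: circ_norm_commute[of "coord v"])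
qed

text \<open>The shifts by \<open>1/2\<close> select the representative of \<open>x\<close> modulo
  \<open>1\<close> in the interval underlying \<open>cycle\<close>.\<close>

definition point :: "real \<Rightarrow> cycle" where
  "point x = of_coord (frac (x + 1/2) - 1/2)"

lemma coord_point: "coord (point x) = x - of_int \<lfloor>x + 1/2\<rfloor>"
proof -
  have "frac (x + 1/2) - 1/2 \<in> {-1/2..<1/2}"
    using frac_lt_1[of "x + 1/2"] by simp
  then have "coord (point x) = frac (x + 1/2) - 1/2"
    unfolding point_def by (rule of_coord_inverse)
  then show ?thesis by (simp add: frac_def)
qed

lemma cdist_point: "cdist v (point x) = circ_norm (x - coord v)"
proof -
  have "cdist v (point x) = circ_norm (x - coord v - of_int \<lfloor>x + 1/2\<rfloor>)"
    unfolding cdist_circ_norm coord_point by (simp add: algebra_simps)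
  then show ?thesis
    using circ_norm_add_int[of "x - coord v - of_int \<lfloor>x + 1/2\<rfloor>" "\<lfloor>x + 1/2\<rfloor>"] by simp
qed

subsection \<open>Proportional circle distance on lifted profiles\<close>

definition lift :: "real list \<Rightarrow> nat \<Rightarrow> real" where
  "lift xs j = xs ! (j mod length xs) + real (j div length xs)"

lemma lift_less [simp]: "j < length xs \<Longrightarrow> lift xs j = xs ! j"
  by (simp add: lift_def)

lemma lift_add_length [simp]: "xs \<noteq> [] \<Longrightarrow> lift xs (j + length xs) = lift xs j + 1"
  by (simp add: lift_def)

lemma lift_ge:
  assumes "length xs \<le> j" "j < 2 * length xs"
  shows "lift xs j = xs ! (j - length xs) + 1"
proof -
  have "xs \<noteq> []" using assms by auto
  then show ?thesis using lift_add_length[of xs "j - length xs"] assms by simp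
qed

definition arc_weight :: "real list \<Rightarrow> nat \<Rightarrow> real" where
  "arc_weight xs j = lift xs (j + length xs div 2 + 1) - lift xs (j + length xs div 2)"

text \<open>
  For a list \<open>xs\<close> of odd length, \<open>pcd g xs\<close> is the expectation of \<open>g\<close> under PCD. Only sorted lists
  contained in an interval of length \<open>1\<close> are meaningful.
\<close>

definition pcd :: "(real \<Rightarrow> real) \<Rightarrow> real list \<Rightarrow> real" where
  "pcd g xs = (\<Sum>j<length xs. arc_weight xs j * g (lift xs j))"

definition periodic1 :: "(real \<Rightarrow> real) \<Rightarrow> bool" where
  "periodic1 g \<longleftrightarrow> (\<forall>x. g (x + 1) = g x)"

lemma lift_rotate1: "lift (xs @ [x + 1]) j = lift (x # xs) (Suc j)"
proof -
  let ?n = "Suc (length xs)"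
  show ?thesis
  proof (cases "Suc (j mod ?n) = ?n")
    case True
    then have j: "j mod ?n = length xs" by simp
    have "Suc j mod ?n = 0" "Suc j div ?n = Suc (j div ?n)"
      using True by (auto simp: mod_Suc div_Suc)
    then show ?thesis by (simp add: lift_def j nth_append)
  next
    case False
    then have "Suc j mod ?n = Suc (j mod ?n)" "Suc j div ?n = j div ?n"
      by (auto simp: mod_Suc div_Suc)
    moreover have "j mod ?n < ?n" by simp
    then have "j mod ?n < length xs" using False by linarith
    ultimately show ?thesis by (simp add: lift_def nth_append)
  qed
qed

text \<open>Moving the first entry to the end, one turn later, shifts all indices by one. As
  \<open>g\<close> is periodic, the summand that leaves the sum equals the one that enters.\<close>

lemma pcd_rotate1:
  assumes "periodic1 g"
  shows "pcd g (xs @ [x + 1]) = pcd g (x # xs)"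
proof -
  let ?n = "Suc (length xs)"
  define h where "h j = arc_weight (x # xs) j * g (lift (x # xs) j)" for j
  have "lift (x # xs) (j + ?n) = lift (x # xs) j + 1" for j
    using lift_add_length[of "x # xs" j] by simp
  from this[of 0] this[of "?n div 2"] this[of "?n div 2 + 1"]
  have "lift (x # xs) ?n = lift (x # xs) 0 + 1"
    "lift (x # xs) (?n + ?n div 2) = lift (x # xs) (?n div 2) + 1"
    "lift (x # xs) (?n + ?n div 2 + 1) = lift (x # xs) (?n div 2 + 1) + 1"
    by (simp_all only: ac_simps add_0_left)
  then have "h ?n = h 0"
    using assms unfolding periodic1_def h_def arc_weight_def
    by (simp only: length_Cons add_0_left) simp
  have "pcd g (xs @ [x + 1]) = (\<Sum>j<?n. h (Suc j))"
    by (simp add: pcd_def h_def arc_weight_def lift_rotate1)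
  also have "\<dots> = (\<Sum>j<?n. h j)"
    using \<open>h ?n = h 0\<close> sum.lessThan_Suc_shift[of h "length xs"] by simp
  also have "\<dots> = pcd g (x # xs)" by (simp add: pcd_def h_def)
  finally show ?thesis .
qed

lemma pcd_rotate:
  assumes "periodic1 g"
  shows "pcd g (xs @ ys) = pcd g (ys @ map (\<lambda>x. x + 1) xs)"
proof (induction xs arbitrary: ys)
  case (Cons x xs)
  have "pcd g ((x # xs) @ ys) = pcd g (xs @ ys @ [x + 1])"
    using pcd_rotate1[OF assms, of "xs @ ys" x] by simp
  also have "\<dots> = pcd g (ys @ map (\<lambda>x. x + 1) (x # xs))"
    using Cons.IH[of "ys @ [x + 1]"] by simp
  finally show ?case .
qed simp

text \<open>One turn later the first entry bounds just the arcs opposite to entries \<open>k\<close>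
  and \<open>Suc k\<close>, and its own opposite arc does not involve it. So only three summands
  change.\<close>

lemma pcd_Cons:
  assumes len: "length fs = 2 * k" and k: "k > 0"
  shows "pcd g (w # fs) - pcd g (w' # fs) =
    (fs ! k - fs ! (k - 1)) * (g w - g w') + (w - w') * (g (fs ! (k - 1)) - g (fs ! k))"
proof -
  define d where "d j = arc_weight (w # fs) j * g (lift (w # fs) j)
    - arc_weight (w' # fs) j * g (lift (w' # fs) j)" for j
  have "d j = 0" if "j < Suc (2*k)" "j \<notin> {0, k, Suc k}" for j
  proof (cases "j < k")
    case True
    with that len k show ?thesis by (simp add: d_def arc_weight_def nth_Cons')
  next
    case False
    with that len k show ?thesis by (simp add: d_def arc_weight_def lift_ge nth_Cons')
  qed
  then have "(\<Sum>j<Suc (2*k). d j) = (\<Sum>j\<in>{0, k, Suc k}. d j)"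
    using k by (intro sum.mono_neutral_right) auto
  also have "\<dots> = d 0 + d k + d (Suc k)" using k by simp
  also have "d 0 = (fs ! k - fs ! (k - 1)) * (g w - g w')"
    using len k by (simp add: d_def arc_weight_def nth_Cons' algebra_simps)
  also have "d k = (w - w') * g (fs ! (k - 1))"
    using len k by (simp add: d_def arc_weight_def lift_ge nth_Cons' algebra_simps)
  also have "d (Suc k) = (w' - w) * g (fs ! k)"
    using len k by (simp add: d_def arc_weight_def lift_ge nth_Cons' algebra_simps)
  finally show ?thesis
    using len by (simp add: pcd_def d_def sum_subtractf algebra_simps)
qed

subsection \<open>The sorted lift of a profile\<close>

text \<open>The profile cut open at \<open>a\<close>. Keeping \<open>a\<close> free lets each
  argument choose its cut: at an ideal point for truthfulness, at an antipode for medians.\<close>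

definition window :: "real \<Rightarrow> ('n::finite \<Rightarrow> cycle) \<Rightarrow> real list" where
  "window a b = sorted_list_of_multiset {# a + frac (coord (b i) - a). i \<in># mset_set UNIV #}"

lemma mset_window: "mset (window a b) = {# a + frac (coord (b i) - a). i \<in># mset_set UNIV #}"
  by (simp add: window_def)

lemma sorted_window [simp]: "sorted (window a b)"
  by (simp add: window_def)

lemma length_window [simp]: "length (window a (b :: 'n::finite \<Rightarrow> cycle)) = CARD('n)"
proof -
  have "length (window a b) = size (mset (window a b))" by simp
  then show ?thesis unfolding mset_window by simp
qed

lemma set_window: "set (window a b) = range (\<lambda>i. a + frac (coord (b i) - a))"
proof -
  have "set (window a b) = set_mset (mset (window a b))" by simp
  then show ?thesis unfolding mset_window by simp
qed

lemma window_bounds: "x \<in> set (window a b) \<Longrightarrow> a \<le> x \<and> x < a + 1"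
  using frac_lt_1 by (auto simp: set_window)

lemma periodic1_add_int:
  assumes "periodic1 g"
  shows "g (x + of_int m) = g x"
proof -
  have nat: "g (x + real n) = g x" for x n
  proof (induction n)
    case (Suc n)
    have "g (x + real (Suc n)) = g (x + real n + 1)" by (simp add: algebra_simps)
    then show ?case using Suc assms by (simp add: periodic1_def)
  qed simp
  show ?thesis
  proof (cases "m \<ge> 0")
    case True
    then show ?thesis using nat[of x "nat m"] by simp
  next
    case False
    then show ?thesis using nat[of "x + of_int m" "nat (- m)"] by simp
  qed
qed

lemma sum_window:
  assumes "periodic1 g"
  shows "(\<Sum>j<CARD('n). g (window a (b :: 'n::finite \<Rightarrow> cycle) ! j)) = (\<Sum>i\<in>UNIV. g (coord (b i)))"
proof -
  have "(\<Sum>j<CARD('n). g (window a b ! j)) = sum_list (map g (window a b))"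
    by (simp add: sum_list_sum_nth atLeast0LessThan)
  also have "\<dots> = sum_mset (image_mset g (mset (window a b)))"
    by (metis mset_map sum_mset_sum_list)
  also have "\<dots> = (\<Sum>i\<in>UNIV. g (a + frac (coord (b i) - a)))"
    unfolding mset_window by (simp add: multiset.map_comp comp_def sum_unfold_sum_mset)
  also have "\<dots> = (\<Sum>i\<in>UNIV. g (coord (b i)))"
  proof (rule sum.cong)
    fix i
    have "a + frac (coord (b i) - a) = coord (b i) + of_int (- \<lfloor>coord (b i) - a\<rfloor>)"
      by (simp add: frac_def)
    then show "g (a + frac (coord (b i) - a)) = g (coord (b i))"
      using periodic1_add_int[OF assms] by metis
  qed simp
  finally show ?thesis .
qed

lemma sorted_partition:
  fixes xs :: "real list"
  assumes "sorted xs"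
  shows "xs = filter (\<lambda>x. x < a) xs @ filter (\<lambda>x. \<not> x < a) xs"
  using assms
proof (induction xs)
  case (Cons x xs)
  show ?case
  proof (cases "x < a")
    case False
    then have "filter (\<lambda>x. x < a) xs = []" using Cons.prems by (auto simp: filter_empty_conv)
    with False Cons show ?thesis by simp
  qed (use Cons in simp)
qed simp

text \<open>Moving the cut past some entries sends them to the end, one turn later. This is a
  rotation, so PCD does not depend on the cut.\<close>

lemma pcd_window_shift:
  assumes g: "periodic1 g" and a: "a \<le> a'" "a' \<le> a + 1"
  shows "pcd g (window a b) = pcd g (window a' b)"
proof -
  define xs where "xs = window a b"
  define ps where "ps = filter (\<lambda>x. x < a') xs"
  define qs where "qs = filter (\<lambda>x. \<not> x < a') xs"
  have bnd: "a \<le> x" "x < a + 1" if "x \<in> set xs" for x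
    using that window_bounds unfolding xs_def by auto
  have xs: "xs = ps @ qs"
    unfolding ps_def qs_def by (rule sorted_partition) (simp add: xs_def)
  have srt: "sorted ps" "sorted qs"
    unfolding ps_def qs_def xs_def by (auto simp: sorted_wrt_filter)
  have shift: "a' + frac (u - a') = (let y = a + frac (u - a) in if y < a' then y + 1 else y)" for u
  proof -
    define y where "y = a + frac (u - a)"
    have y: "a \<le> y" "y < a + 1" using frac_lt_1[of "u - a"] by (auto simp: y_def)
    have "frac (u - a') = (if y < a' then y + 1 - a' else y - a')"
      unfolding frac_unique_iff using y a by (auto simp: y_def frac_def)
    then show ?thesis unfolding Let_def y_def[symmetric] by simp
  qed
  have "mset (window a' b) = image_mset (\<lambda>y. if y < a' then y + 1 else y) (mset xs)"
    unfolding xs_def mset_window by (simp add: multiset.map_comp comp_def shift Let_def)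
  also have "\<dots> = mset (qs @ map (\<lambda>x. x + 1) ps)"
  proof -
    have "map (\<lambda>y. if y < a' then y + 1 else y) ps = map (\<lambda>x. x + 1) ps"
      "map (\<lambda>y. if y < a' then y + 1 else y) qs = qs"
      by (auto simp: ps_def qs_def intro: map_idI)
    then have "mset (map (\<lambda>y. if y < a' then y + 1 else y) xs) = mset (qs @ map (\<lambda>x. x + 1) ps)"
      by (simp only: xs map_append mset_append add.commute)
    then show ?thesis by (simp only: mset_map)
  qed
  finally have ms: "mset (window a' b) = mset (qs @ map (\<lambda>x. x + 1) ps)" .
  have "sorted (map (\<lambda>x. x + 1) ps)" using srt(1) by (simp add: sorted_map)
  moreover have "y \<le> x + 1" if "x \<in> set ps" "y \<in> set qs" for x y
    using that bnd[of x] bnd[of y] unfolding ps_def qs_def by auto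
  ultimately have "sorted (qs @ map (\<lambda>x. x + 1) ps)"
    using srt(2) by (auto simp: sorted_append)
  with ms have "window a' b = qs @ map (\<lambda>x. x + 1) ps"
    using properties_for_sort[of "qs @ map (\<lambda>x. x + 1) ps" "window a' b"]
    by (simp add: sorted_sort_id)
  then show ?thesis
    using pcd_rotate[OF g, of ps qs] xs unfolding xs_def by simp
qed

subsection \<open>Strategyproofness\<close>

text \<open>Here \<open>p\<close> is the length of the opposite arc, which depends on the position
  \<open>j\<close> but not on the report. The shifted weight \<open>|w - w'|\<close> goes between
  the ends of this arc, where the values of \<open>g\<close> differ by at most
  \<open>p\<close>.\<close>

lemma pcd_move:
  assumes es: "sorted es" "length es = 2 * k" "k > 0" "set es \<subseteq> {a..a + 1}"
    and g: "periodic1 g" "\<And>x y. \<bar>g x - g y\<bar> \<le> \<bar>x - y\<bar>"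
  shows "\<exists>p\<ge>0. \<forall>w w'. \<bar>pcd g (take j es @ w # drop j es) - pcd g (take j es @ w' # drop j es)
    - p * (g w - g w')\<bar> \<le> p * \<bar>w - w'\<bar>"
proof -
  \<comment> \<open>Rotating the list brings the report to the front; its opposite arc then ends at
    positions \<open>k - 1\<close> and \<open>k\<close> of \<open>fs\<close>.\<close>
  define fs where "fs = drop j es @ map (\<lambda>x. x + 1) (take j es)"
  have len: "length fs = 2 * k" using es(2) by (simp add: fs_def)
  have "y \<le> x + 1" if "x \<in> set (take j es)" "y \<in> set (drop j es)" for x y
  proof -
    have "x \<in> {a..a + 1}" "y \<in> {a..a + 1}"
      using in_set_takeD[OF that(1)] in_set_dropD[OF that(2)] es(4) by blast+
    then show ?thesis by simp
  qed
  then have "sorted fs"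
    using es(1) by (auto simp: fs_def sorted_append sorted_map intro: sorted_wrt_take sorted_wrt_drop)
  then have p: "fs ! k - fs ! (k - 1) \<ge> 0"
    using len es(3) by (simp add: sorted_iff_nth_mono)
  have rot: "pcd g (take j es @ w # drop j es) = pcd g (w # fs)" for w
    using pcd_rotate[OF g(1), of "take j es" "w # drop j es"] by (simp add: fs_def)
  have "\<bar>pcd g (w # fs) - pcd g (w' # fs) - (fs ! k - fs ! (k - 1)) * (g w - g w')\<bar>
      \<le> (fs ! k - fs ! (k - 1)) * \<bar>w - w'\<bar>" for w w'
  proof -
    have "\<bar>(w - w') * (g (fs ! (k - 1)) - g (fs ! k))\<bar> \<le> \<bar>w - w'\<bar> * (fs ! k - fs ! (k - 1))"
      using g(2)[of "fs ! (k - 1)" "fs ! k"] p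
      unfolding abs_mult by (intro mult_left_mono) auto
    then show ?thesis
      unfolding pcd_Cons[OF len es(3)] by (simp add: mult.commute)
  qed
  with p show ?thesis unfolding rot by blast
qed

lemma insort_eq_take_drop:
  fixes es :: "real list"
  assumes "sorted es"
  obtains j where "j \<le> length es" "insort w es = take j es @ w # drop j es"
    "\<And>i. i < j \<Longrightarrow> es ! i \<le> w" "\<And>i. j \<le> i \<Longrightarrow> i < length es \<Longrightarrow> w \<le> es ! i"
proof -
  define ps where "ps = filter (\<lambda>x. x < w) es"
  define qs where "qs = filter (\<lambda>x. \<not> x < w) es"
  have es: "es = ps @ qs"
    unfolding ps_def qs_def by (rule sorted_partition) fact
  have "sorted ps" "sorted qs" using assms unfolding es by (auto simp: sorted_append)
  then have "sorted (ps @ w # qs)"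
    by (auto simp: sorted_append ps_def qs_def)
  moreover have "mset (ps @ w # qs) = mset (insort w es)" by (simp add: es)
  ultimately have ins: "insort w es = ps @ w # qs"
    using properties_for_sort[of "ps @ w # qs" "insort w es"] assms
    by (simp add: sorted_sort_id sorted_insort)
  show thesis
  proof (rule that[of "length ps"])
    show "es ! i \<le> w" if "i < length ps" for i
    proof -
      have "es ! i \<in> set ps" using that by (simp add: es nth_append)
      then show ?thesis by (simp add: ps_def)
    qed
    show "w \<le> es ! i" if "length ps \<le> i" "i < length es" for i
    proof -
      have "es ! i \<in> set qs" using that by (simp add: es nth_append)
      then show ?thesis by (simp add: qs_def)
    qed
  qed (use ins in \<open>simp_all add: es\<close>)
qed

lemma periodic1_circ_norm [simp]: "periodic1 (\<lambda>x. circ_norm (x - t))"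
  unfolding periodic1_def
proof
  fix x
  show "circ_norm (x + 1 - t) = circ_norm (x - t)"
    using circ_norm_add_1[of "x - t"] by (simp add: algebra_simps)
qed

lemma pcd_truthful:
  assumes es: "sorted es" "length es = 2 * k" "k > 0" "set es \<subseteq> {t..t + 1}"
    and w: "t \<le> w" "w \<le> t + 1"
  shows "pcd (\<lambda>x. circ_norm (x - t)) (t # es) \<le> pcd (\<lambda>x. circ_norm (x - t)) (insort w es)"
proof -
  define g where "g = (\<lambda>x. circ_norm (x - t))"
  \<comment> \<open>\<open>H j u\<close> keeps the report in slot \<open>j\<close> even if this
    breaks the order. Slots \<open>j\<close> and \<open>Suc j\<close> agree at
    \<open>u = es ! j\<close>, which is how the report passes an agent.\<close>
  define H where "H j u = pcd g (take j es @ u # drop j es)" for j u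
  have g: "periodic1 g" unfolding g_def by simp
  have lip: "\<bar>g x - g y\<bar> \<le> \<bar>x - y\<bar>" for x y
    using circ_norm_lipschitz[of "x - t" "y - t"] by (simp add: g_def)
  have bnd: "t \<le> es ! i" "es ! i \<le> t + 1" if "i < 2 * k" for i
    using that es(2,4) nth_mem[of i es] by (auto simp: subset_iff)
  have g_up: "g x = x - t" if "t \<le> x" "x \<le> t + 1/2" for x
    using that by (simp add: g_def circ_norm_eq_abs)
  have g_down: "g x = t + 1 - x" if "t + 1/2 \<le> x" "x \<le> t + 1" for x
    using that circ_norm_eq_abs[of "x - t - 1"] circ_norm_add_1[of "x - t - 1"] by (simp add: g_def)
  \<comment> \<open>If \<open>g\<close> grows with slope one, the main term of
    \<open>pcd_move\<close> absorbs the whole error term.\<close>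
  have mono: "H j u \<le> H j u'" if "g u' - g u = \<bar>u' - u\<bar>" for j u u'
  proof -
    obtain p where "\<bar>H j u' - H j u - p * (g u' - g u)\<bar> \<le> p * \<bar>u' - u\<bar>"
      using pcd_move[OF es g lip, of j] unfolding H_def by blast
    then show ?thesis using that by (simp add: abs_le_iff)
  qed
  \<comment> \<open>From \<open>t\<close> towards its antipode: the report stops at each agent on
    the way, changes slot there and moves on.\<close>
  have up: "H 0 t \<le> H j u" if "j \<le> 2 * k" "\<And>i. i < j \<Longrightarrow> es ! i \<le> u" "t \<le> u" "u \<le> t + 1/2" for j u
    using that
  proof (induction j arbitrary: u)
    case 0
    then show ?case using mono[of u t 0] g_up[of u] g_up[of t] by simp
  next
    case (Suc j)
    have "es ! i \<le> es ! j" if "i < j" for i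
      using that es(1,2) Suc.prems(1) by (simp add: sorted_iff_nth_mono)
    moreover have e: "t \<le> es ! j" "es ! j \<le> u" using bnd[of j] Suc.prems by auto
    moreover have e': "es ! j \<le> t + 1/2" using e(2) Suc.prems(4) by linarith
    ultimately have "H 0 t \<le> H j (es ! j)" using Suc.prems by (intro Suc.IH) auto
    also have "\<dots> = H (Suc j) (es ! j)"
      using Suc.prems(1) es(2) by (simp add: H_def take_Suc_conv_app_nth Cons_nth_drop_Suc)
    also have "\<dots> \<le> H (Suc j) u"
      using e e' Suc.prems(3,4) by (intro mono) (simp add: g_up)
    finally show ?case .
  qed
  \<comment> \<open>The other way round the circle, from \<open>t + 1\<close> down towards the
    antipode, where \<open>g\<close> is the distance to \<open>t + 1\<close>.\<close>
  have down: "H (2 * k) (t + 1) \<le> H j u"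
    if "j \<le> 2 * k" "\<And>i. j \<le> i \<Longrightarrow> i < 2 * k \<Longrightarrow> u \<le> es ! i" "t + 1/2 \<le> u" "u \<le> t + 1" for j u
    using that
  proof (induction j arbitrary: u rule: inc_induct)
    case base
    then show ?case by (intro mono) (simp add: g_down)
  next
    case (step j)
    have "es ! j \<le> es ! i" if "Suc j \<le> i" "i < 2 * k" for i
      using that es(1,2) by (simp add: sorted_iff_nth_mono)
    moreover have e: "u \<le> es ! j" "es ! j \<le> t + 1" using bnd[of j] step by auto
    ultimately have "H (2 * k) (t + 1) \<le> H (Suc j) (es ! j)"
      using step.prems by (intro step.IH) auto
    also have "\<dots> = H j (es ! j)"
      using step.hyps es(2) by (simp add: H_def take_Suc_conv_app_nth Cons_nth_drop_Suc)
    also have "\<dots> \<le> H j u"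
      using e step.prems by (intro mono) (simp add: g_down)
    finally show ?case .
  qed
  obtain j where j: "j \<le> length es" "insort w es = take j es @ w # drop j es"
    "\<And>i. i < j \<Longrightarrow> es ! i \<le> w" "\<And>i. j \<le> i \<Longrightarrow> i < length es \<Longrightarrow> w \<le> es ! i"
    using insort_eq_take_drop[OF es(1), of w] by metis
  \<comment> \<open>A rotation relates the truthful report at the front to the same report one turn
    later at the end, so both journeys start from the same value.\<close>
  have "H 0 t = H (2 * k) (t + 1)"
    using pcd_rotate1[OF g, of es t] es(2) by (simp add: H_def)
  then have "H 0 t \<le> H j w"
    using up[of j w] down[of j w] j w es(2) by (cases "w \<le> t + 1/2") auto
  then show ?thesis by (simp add: H_def g_def j(2))
qed

section \<open>The lottery of the mechanism and its expected costs\<close>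

lemma lift_mono:
  assumes "sorted xs" "xs \<noteq> []" "set xs \<subseteq> {a..a + 1}"
  shows "lift xs j \<le> lift xs (Suc j)"
proof -
  let ?n = "length xs"
  have n: "?n > 0" using assms(2) by simp
  show ?thesis
  proof (cases "Suc (j mod ?n) = ?n")
    case True
    then have "Suc j mod ?n = 0" "Suc j div ?n = Suc (j div ?n)"
      by (auto simp: mod_Suc div_Suc)
    \<comment> \<open>At the turn, the last entry is at most \<open>a + 1\<close>, hence at most one
      more than the first.\<close>
    moreover have "xs ! (j mod ?n) \<in> {a..a + 1}" "xs ! 0 \<in> {a..a + 1}"
      using n by (intro subsetD[OF assms(3)] nth_mem; simp)+
    ultimately show ?thesis by (simp add: lift_def)
  next
    case False
    then have "Suc j mod ?n = Suc (j mod ?n)" "Suc j div ?n = j div ?n"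
      by (auto simp: mod_Suc div_Suc)
    moreover have "j mod ?n < ?n" using n by simp
    then have "Suc (j mod ?n) < ?n" using False by linarith
    ultimately show ?thesis using assms(1) by (simp add: lift_def sorted_iff_nth_Suc)
  qed
qed

lemma arc_weight_nonneg:
  assumes "sorted xs" "xs \<noteq> []" "set xs \<subseteq> {a..a + 1}"
  shows "arc_weight xs j \<ge> 0"
  using lift_mono[OF assms] by (simp add: arc_weight_def)

lemma sum_arc_weight:
  assumes "xs \<noteq> []"
  shows "(\<Sum>j<length xs. arc_weight xs j) = 1"
proof -
  have "(\<Sum>j<m. arc_weight xs j) = lift xs (m + length xs div 2) - lift xs (length xs div 2)" for m
    by (induction m) (simp_all add: arc_weight_def)
  then show ?thesis
    using lift_add_length[OF assms, of "length xs div 2"] by (simp add: add.commute)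
qed

text \<open>The weights live on list positions, so coinciding agents keep separate entries; the
  value \<open>0\<close> off the list makes this a mass function on all naturals.\<close>

definition mix_weight :: "real list \<Rightarrow> nat \<Rightarrow> real" where
  "mix_weight xs j = (if j < length xs then (1 / real (length xs) + arc_weight xs j) / 2 else 0)"

definition mechanism :: "('n::finite \<Rightarrow> cycle) \<Rightarrow> cycle pmf" where
  "mechanism b = (let xs = window (-1/2) b in
     map_pmf (\<lambda>j. point (xs ! j)) (embed_pmf (mix_weight xs)))"

lemma pmf_embed_mix_weight:
  assumes "sorted xs" "xs \<noteq> []" "set xs \<subseteq> {a..a + 1}"
  shows "pmf (embed_pmf (mix_weight xs)) = mix_weight xs"
proof -
  have nonneg: "mix_weight xs j \<ge> 0" for j
    using arc_weight_nonneg[OF assms] by (simp add: mix_weight_def)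
  have "(\<integral>\<^sup>+j. ennreal (mix_weight xs j) \<partial>count_space UNIV)
      = (\<Sum>j<length xs. ennreal (mix_weight xs j))"
    by (rule nn_integral_count_space') (auto simp: mix_weight_def)
  also have "\<dots> = ennreal (\<Sum>j<length xs. mix_weight xs j)"
    using nonneg by simp
  also have "(\<Sum>j<length xs. mix_weight xs j) = 1"
    using sum_arc_weight[OF assms(2)] assms(2)
    by (simp add: mix_weight_def sum.distrib flip: sum_divide_distrib)
  finally show ?thesis
    using nonneg by (intro ext pmf_embed_pmf) simp_all
qed

lemma expectation_mechanism:
  fixes b :: "'n::finite \<Rightarrow> cycle"
  assumes h: "\<And>x. h (point x) = g x" and g: "periodic1 g"
  shows "measure_pmf.expectation (mechanism b) h
    = ((\<Sum>i\<in>UNIV. g (coord (b i))) / real CARD('n) + pcd g (window (-1/2) b)) / 2"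
proof -
  define xs where "xs = window (-1/2) b"
  have len: "length xs = CARD('n)" by (simp add: xs_def)
  then have "length xs > 0" by simp
  then have ne: "xs \<noteq> []" by simp
  have sub: "set xs \<subseteq> {-1/2..-1/2 + 1}"
    using window_bounds unfolding xs_def by fastforce
  have pmf: "pmf (embed_pmf (mix_weight xs)) = mix_weight xs"
    by (rule pmf_embed_mix_weight[OF _ ne sub]) (simp add: xs_def)
  have "measure_pmf.expectation (mechanism b) h
      = measure_pmf.expectation (embed_pmf (mix_weight xs)) (\<lambda>j. g (xs ! j))"
    by (simp add: mechanism_def Let_def xs_def h)
  also have "\<dots> = (\<Sum>j<length xs. g (xs ! j) * mix_weight xs j)"
    by (subst integral_measure_pmf_real[where A = "{..<length xs}"])
      (auto simp: set_pmf_iff pmf mix_weight_def split: if_splits)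
  also have "\<dots> = (\<Sum>j<length xs. g (xs ! j) / real (length xs) / 2 + arc_weight xs j * g (lift xs j) / 2)"
    by (rule sum.cong) (simp_all add: mix_weight_def field_simps)
  also have "\<dots> = ((\<Sum>j<length xs. g (xs ! j)) / real (length xs) + pcd g xs) / 2"
    unfolding sum.distrib pcd_def add_divide_distrib by (simp add: sum_divide_distrib)
  also have "(\<Sum>j<length xs. g (xs ! j)) = (\<Sum>i\<in>UNIV. g (coord (b i)))"
    unfolding len unfolding xs_def by (rule sum_window[OF g])
  finally show ?thesis by (simp add: xs_def)
qed

lemma cost_mechanism:
  fixes b :: "'n::finite \<Rightarrow> cycle"
  shows "cost v (mechanism b) = ((\<Sum>i\<in>UNIV. circ_norm (coord (b i) - coord v)) / real CARD('n)
    + pcd (\<lambda>x. circ_norm (x - coord v)) (window (-1/2) b)) / 2"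
  unfolding cost_def by (rule expectation_mechanism) (simp_all add: cdist_point)

text \<open>Splits off the report of agent \<open>i\<close>, the form in which
  \<open>pcd_truthful\<close> takes it.\<close>

lemma window_upd:
  "window a (b(i := v)) = insort (a + frac (coord v - a))
     (sorted_list_of_multiset {# a + frac (coord (b i') - a). i' \<in># mset_set (UNIV - {i}) #})"
proof -
  have "{# a + frac (coord ((b(i := v)) i') - a). i' \<in># mset_set UNIV #}
      = add_mset (a + frac (coord v - a))
          {# a + frac (coord ((b(i := v)) i') - a). i' \<in># mset_set (UNIV - {i}) #}"
    by (subst mset_set.remove[of _ i]) simp_all
  also have "{# a + frac (coord ((b(i := v)) i') - a). i' \<in># mset_set (UNIV - {i}) #}
      = {# a + frac (coord (b i') - a). i' \<in># mset_set (UNIV - {i}) #}"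
    by (rule image_mset_cong) auto
  finally show ?thesis by (simp add: window_def)
qed

lemma strategyproof_mechanism:
  assumes "odd CARD('n::finite)" and "CARD('n) \<ge> 3"
  shows "strategyproof (mechanism :: ('n \<Rightarrow> cycle) \<Rightarrow> cycle pmf)"
  unfolding strategyproof_def
proof (intro allI)
  fix b :: "'n \<Rightarrow> cycle" and i v
  \<comment> \<open>Cutting at the ideal point puts the truthful report first and every other report
    in \<open>{t..t + 1}\<close>.\<close>
  define t where "t = coord (b i)"
  define b' where "b' = b(i := v)"
  define M where "M = {# t + frac (coord (b i') - t). i' \<in># mset_set (UNIV - {i}) #}"
  define es where "es = sorted_list_of_multiset M"
  have t: "-1/2 \<le> t" "t < 1/2" using coord[of "b i"] by (auto simp: t_def)
  obtain k where k: "CARD('n) = 2 * k + 1" using assms(1) by (auto elim: oddE)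
  have len: "length es = 2 * k"
  proof -
    have "length es = size (mset es)" by simp
    also have "\<dots> = 2 * k" using k by (simp add: es_def M_def)
    finally show ?thesis .
  qed
  have "set es = set_mset M" by (simp add: es_def)
  then have sub: "set es \<subseteq> {t..t + 1}"
    using frac_lt_1[where 'a = real, THEN less_imp_le] by (auto simp: M_def)
  have srt: "sorted es" by (simp add: es_def)
  have "window t b = insort t es"
    using window_upd[of t b i "b i"] by (simp add: t_def es_def M_def)
  also have "\<dots> = t # es" using sub by (intro insort_is_Cons) auto
  finally have wb: "window t b = t # es" .
  have wb': "window t b' = insort (t + frac (coord v - t)) es"
    unfolding b'_def window_upd es_def M_def ..
  \<comment> \<open>Under the random dictator only the deviator's own summand changes, and it is
    zero when truthful.\<close>
  have "(\<Sum>i'\<in>UNIV. circ_norm (coord (b i') - t)) \<le> (\<Sum>i'\<in>UNIV. circ_norm (coord (b' i') - t))"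
    by (rule sum_mono) (auto simp: b'_def t_def circ_norm_small)
  moreover have "pcd (\<lambda>x. circ_norm (x - t)) (window t b) \<le> pcd (\<lambda>x. circ_norm (x - t)) (window t b')"
    unfolding wb wb' using k assms(2) frac_lt_1[of "coord v - t"]
    by (intro pcd_truthful[OF srt len _ sub]) auto
  moreover have "pcd (\<lambda>x. circ_norm (x - t)) (window (-1/2) c) = pcd (\<lambda>x. circ_norm (x - t)) (window t c)"
    for c :: "'n \<Rightarrow> cycle"
    using t by (intro pcd_window_shift) auto
  ultimately show "cost (b i) (mechanism b) \<le> cost (b i) (mechanism (b(i := v)))"
    unfolding cost_mechanism t_def[symmetric] b'_def[symmetric]
    by (intro divide_right_mono add_mono) auto
qed

subsection \<open>The approximation ratio\<close>

lemma sum_step_function: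
  fixes c d :: real
  shows "m \<le> n \<Longrightarrow> (\<Sum>j<n. if j < m then c else d) = real m * c + real (n - m) * d"
proof (induction n)
  case (Suc n)
  show ?case
  proof (cases "m = Suc n")
    case True
    then have "(\<Sum>j<Suc n. if j < m then c else d) = (\<Sum>j<Suc n. c)" by (intro sum.cong) auto
    then show ?thesis using True by simp
  next
    case False
    with Suc have "m \<le> n" by simp
    with Suc.IH show ?thesis by (simp add: Suc_diff_le algebra_simps)
  qed
qed simp

text \<open>The induction peels off both ends and applies the hypothesis to \<open>h\<close> shifted
  by one.\<close>

lemma sum_around_middle:
  fixes h :: "nat \<Rightarrow> real"
  shows "(\<Sum>j<2 * k + 1. h j) = h k + (\<Sum>i=1..k. h (k + i) + h (k - i))"
proof (induction k arbitrary: h)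
  case (Suc k)
  have "(\<Sum>j<2 * Suc k + 1. h j) = h 0 + (\<Sum>j<2 * k + 1. h (Suc j)) + h (Suc (2 * k + 1))"
  proof -
    have "2 * Suc k + 1 = Suc (Suc (2 * k + 1))" by simp
    then have "(\<Sum>j<2 * Suc k + 1. h j) = (\<Sum>j<Suc (2 * k + 1). h j) + h (Suc (2 * k + 1))"
      by (simp only: sum.lessThan_Suc)
    then show ?thesis by (simp only: sum.lessThan_Suc_shift)
  qed
  also have "(\<Sum>j<2 * k + 1. h (Suc j)) = h (Suc k) + (\<Sum>i=1..k. h (Suc (k + i)) + h (Suc (k - i)))"
    by (rule Suc.IH)
  also have "(\<Sum>i=1..k. h (Suc (k + i)) + h (Suc (k - i))) = (\<Sum>i=1..k. h (Suc k + i) + h (Suc k - i))"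
    by (rule sum.cong) (auto simp: Suc_diff_le)
  finally show ?case by (simp add: mult_2)
qed simp

text \<open>Entry \<open>j\<close> is the upper one in \<open>j\<close> pairs and the lower one in
  \<open>m - 1 - j\<close> pairs, and the double sum counts each pair twice.\<close>

lemma sum_abs_diff_sorted:
  fixes x :: "nat \<Rightarrow> real"
  assumes "\<And>i j. i \<le> j \<Longrightarrow> j < m \<Longrightarrow> x i \<le> x j"
  shows "(\<Sum>i<m. \<Sum>j<m. \<bar>x i - x j\<bar>) = 2 * (\<Sum>j<m. (2 * real j + 1 - real m) * x j)"
  using assms
proof (induction m)
  case (Suc m)
  have last: "(\<Sum>i<m. \<bar>x i - x m\<bar>) = real m * x m - (\<Sum>i<m. x i)"
  proof -
    have "(\<Sum>i<m. \<bar>x i - x m\<bar>) = (\<Sum>i<m. x m - x i)"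
      using Suc.prems by (intro sum.cong) (auto simp: less_imp_le)
    then show ?thesis by (simp add: sum_subtractf)
  qed
  have "(\<Sum>i<Suc m. \<Sum>j<Suc m. \<bar>x i - x j\<bar>)
      = (\<Sum>i<m. \<Sum>j<m. \<bar>x i - x j\<bar>) + 2 * (\<Sum>i<m. \<bar>x i - x m\<bar>)"
    by (simp add: sum.distrib abs_minus_commute[of "x m"])
  also have "\<dots> = 2 * (\<Sum>j<m. (2 * real j + 1 - real m) * x j) + 2 * (real m * x m - (\<Sum>i<m. x i))"
    unfolding last using Suc by simp
  also have "\<dots> = 2 * (\<Sum>j<Suc m. (2 * real j + 1 - real (Suc m)) * x j)"
    by (simp add: algebra_simps sum.distrib sum_subtractf)
  finally show ?case .
qed simp

section \<open>The bilinear inequality in the increments\<close>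

text \<open>This is the coefficient of increment \<open>a\<close> on the linear side of
  \<open>bilinear_bound\<close>, since that increment occurs in \<open>X i\<close> exactly when
  \<open>k < a + i\<close>. The \<open>5/2\<close> is twice the ratio \<open>7/4\<close>, less one
  for the optimum itself; the fraction pays for the random dictator.\<close>

lemma sum_tail_coefficients:
  fixes k :: nat
  defines "n \<equiv> 2 * real k + 1"
  shows "a \<le> k \<Longrightarrow> (\<Sum>i=1..k. if k < a + i then 5/2 - 4 * real i / n else 0) = a / 2 + 2 * (real a)\<^sup>2 / n"
proof (induction a)
  case (Suc a)
  have n: "n > 0" by (simp add: n_def)
  let ?f = "\<lambda>i. 5/2 - 4 * real i / n"
  have "(\<Sum>i=1..k. if k < Suc a + i then ?f i else 0)
      = (\<Sum>i=1..k. (if k < a + i then ?f i else 0) + (if i = k - a then ?f i else 0))"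
    using Suc.prems by (intro sum.cong) auto
  also have "\<dots> = a / 2 + 2 * (real a)\<^sup>2 / n + ?f (k - a)"
  proof -
    have "k - a \<in> {1..k}" using Suc.prems by auto
    then have "(\<Sum>i=1..k. if i = k - a then ?f i else 0) = ?f (k - a)"
      by (subst sum.delta) auto
    then show ?thesis using Suc by (simp add: sum.distrib)
  qed
  also have "\<dots> = Suc a / 2 + 2 * (real (Suc a))\<^sup>2 / n"
    using Suc.prems n by (simp add: of_nat_diff field_simps power2_eq_square) (simp add: n_def algebra_simps)
  finally show ?case .
qed simp

text \<open>
  The increments of \<open>X\<close> are numbered from the far end, because increment \<open>a\<close> is the PCD weight of
  the \<open>a\<close>-th agent on the other side of \<open>z\<close>.
\<close>

lemma telescope_reversed:
  fixes X :: "nat \<Rightarrow> real"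
  assumes "X 0 = 0"
  shows "i \<le> k \<Longrightarrow> X i = (\<Sum>a=1..k. if k < a + i then X (k + 1 - a) - X (k - a) else 0)"
proof (induction i)
  case (Suc i)
  let ?d = "\<lambda>a. X (k + 1 - a) - X (k - a)"
  have "(\<Sum>a=1..k. if k < a + Suc i then ?d a else 0)
      = (\<Sum>a=1..k. (if k < a + i then ?d a else 0) + (if a = k - i then ?d a else 0))"
    using Suc.prems by (intro sum.cong) auto
  also have "\<dots> = X i + ?d (k - i)"
    using Suc by (simp add: sum.distrib)
  also have "\<dots> = X (Suc i)"
    using Suc.prems by (simp add: Suc_diff_le)
  finally show ?case ..
next
  case 0
  have "(\<Sum>a=1..k. if k < a + 0 then X (k + 1 - a) - X (k - a) else 0) = 0"
    by (intro sum.neutral) auto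
  then show ?case using assms by simp
qed

text \<open>Let \<open>s = a + b\<close>. The linear terms give exactly \<open>s / 2\<close>. As
  \<open>2 * k + 1 <= 2 * s\<close> and \<open>s^2 <= 2 * (a^2 + b^2)\<close>, the quadratic terms
  give at least the other half.\<close>

lemma tail_coefficient_bound:
  assumes "k < a + b" "a \<ge> 1" "b \<ge> 1"
  shows "real a + real b \<le> (a / 2 + 2 * (real a)\<^sup>2 / (2 * real k + 1)) + (b / 2 + 2 * (real b)\<^sup>2 / (2 * real k + 1))"
proof -
  define s where "s = real a + real b"
  define n where "n = 2 * real k + 1"
  have n: "0 < n" "n \<le> 2 * s" using assms by (auto simp: n_def s_def)
  have "s\<^sup>2 \<le> 2 * ((real a)\<^sup>2 + (real b)\<^sup>2)"
    using sum_squares_ge_zero[of "real a - real b" 0] by (simp add: s_def power2_eq_square algebra_simps)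
  moreover have "n * s \<le> 2 * s\<^sup>2"
    using mult_right_mono[OF n(2), of s] by (simp add: s_def power2_eq_square mult.assoc[symmetric])
  ultimately have "n * s \<le> 4 * ((real a)\<^sup>2 + (real b)\<^sup>2)" by linarith
  then have "s / 2 \<le> 2 * (real a)\<^sup>2 / n + 2 * (real b)\<^sup>2 / n"
    using n by (simp add: field_simps)
  then show ?thesis by (simp add: s_def n_def)
qed

text \<open>In the increments, the left side has coefficient \<open>2 * (a + b - 1)\<close> at
  \<open>\<alpha> a * \<beta> b\<close> if \<open>k < a + b\<close> and none otherwise. The right
  side is linear but dominates a form with coefficients \<open>2 * (L a + L b)\<close>, and
  \<open>tail_coefficient_bound\<close> compares the two.\<close>

lemma bilinear_bound:
  fixes X Y :: "nat \<Rightarrow> real"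
  assumes X: "X 0 = 0" "\<And>i j. i \<le> j \<Longrightarrow> j \<le> k \<Longrightarrow> X i \<le> X j" "X k \<le> 1/2"
    and Y: "Y 0 = 0" "\<And>i j. i \<le> j \<Longrightarrow> j \<le> k \<Longrightarrow> Y i \<le> Y j" "Y k \<le> 1/2"
  shows "(\<Sum>i=1..k. (2 * real i - 1) * (X i * (Y (k + 1 - i) - Y (k - i)) + Y i * (X (k + 1 - i) - X (k - i))))
    \<le> (\<Sum>i=1..k. (5/2 - 4 * real i / (2 * real k + 1)) * (X i + Y i))"
proof -
  define \<alpha> where "\<alpha> a = X (k + 1 - a) - X (k - a)" for a
  define \<beta> where "\<beta> a = Y (k + 1 - a) - Y (k - a)" for a
  define L where "L a = a / 2 + 2 * (real a)\<^sup>2 / (2 * real k + 1)" for a :: nat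
  define f where "f i = 5/2 - 4 * real i / (2 * real k + 1)" for i :: nat
  have nonneg: "\<alpha> a \<ge> 0" "\<beta> a \<ge> 0" if "a \<in> {1..k}" for a
    using that X(2)[of "k - a" "k + 1 - a"] Y(2)[of "k - a" "k + 1 - a"] by (auto simp: \<alpha>_def \<beta>_def)
  have L_nonneg: "L a \<ge> 0" for a by (simp add: L_def)
  have Xsum: "X i = (\<Sum>a=1..k. if k < a + i then \<alpha> a else 0)" if "i \<le> k" for i
    unfolding \<alpha>_def using telescope_reversed[of X, OF X(1) that] .
  have Ysum: "Y i = (\<Sum>a=1..k. if k < a + i then \<beta> a else 0)" if "i \<le> k" for i
    unfolding \<beta>_def using telescope_reversed[of Y, OF Y(1) that] .
  have linear: "(\<Sum>i=1..k. f i * Z i) = (\<Sum>a=1..k. L a * \<gamma> a)"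
    if "\<And>i. i \<le> k \<Longrightarrow> Z i = (\<Sum>a=1..k. if k < a + i then \<gamma> a else 0)" for Z \<gamma> :: "nat \<Rightarrow> real"
  proof -
    have "(\<Sum>i=1..k. f i * Z i) = (\<Sum>i=1..k. \<Sum>a=1..k. (if k < a + i then f i else 0) * \<gamma> a)"
      using that by (intro sum.cong) (auto simp: sum_distrib_left intro: sum.cong)
    also have "\<dots> = (\<Sum>a=1..k. (\<Sum>i=1..k. if k < a + i then f i else 0) * \<gamma> a)"
      by (subst sum.swap) (simp add: sum_distrib_right)
    finally have "(\<Sum>i=1..k. f i * Z i) = \<dots>" .
    moreover have "(\<Sum>i=1..k. if k < a + i then f i else 0) = L a" if "a \<in> {1..k}" for a
      unfolding f_def L_def using that by (intro sum_tail_coefficients) simp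
    then have "(\<Sum>a=1..k. (\<Sum>i=1..k. if k < a + i then f i else 0) * \<gamma> a) = (\<Sum>a=1..k. L a * \<gamma> a)"
      by simp
    ultimately show ?thesis by (rule trans)
  qed
  \<comment> \<open>Homogenisation: twice the sum of the \<open>\<delta> b\<close> is at most one,
    so multiplying a nonnegative linear form by it cannot increase the form.\<close>
  have le: "(\<Sum>a=1..k. \<Sum>b=1..k. 2 * L a * \<gamma> a * \<delta> b) \<le> (\<Sum>a=1..k. L a * \<gamma> a)"
    if \<gamma>: "\<And>a. a \<in> {1..k} \<Longrightarrow> \<gamma> a \<ge> 0" and \<delta>: "(\<Sum>b=1..k. \<delta> b) \<le> 1/2" for \<gamma> \<delta> :: "nat \<Rightarrow> real"
  proof -
    have "(\<Sum>b=1..k. 2 * L a * \<gamma> a * \<delta> b) \<le> L a * \<gamma> a" if a: "a \<in> {1..k}" for a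
    proof -
      have "(\<Sum>b=1..k. 2 * L a * \<gamma> a * \<delta> b) = (2 * L a * \<gamma> a) * (\<Sum>b=1..k. \<delta> b)"
        by (simp add: sum_distrib_left)
      also have "\<dots> \<le> (2 * L a * \<gamma> a) * (1/2)"
        using \<gamma>[OF a] L_nonneg[of a] \<delta>
        by (intro mult_left_mono) auto
      finally show ?thesis by simp
    qed
    then show ?thesis by (rule sum_mono)
  qed
  have sums: "(\<Sum>a=1..k. \<alpha> a) \<le> 1/2" "(\<Sum>a=1..k. \<beta> a) \<le> 1/2"
  proof -
    have "(\<Sum>a=1..k. if k < a + k then \<gamma> a else 0) = (\<Sum>a=1..k. \<gamma> a)" for \<gamma> :: "nat \<Rightarrow> real"
      by (intro sum.cong) auto
    then show "(\<Sum>a=1..k. \<alpha> a) \<le> 1/2" "(\<Sum>a=1..k. \<beta> a) \<le> 1/2"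
      using X(3) Y(3) Xsum[of k] Ysum[of k] by simp_all
  qed
  have "(\<Sum>i=1..k. (2 * real i - 1) * (X i * \<beta> i + Y i * \<alpha> i))
      = (\<Sum>i=1..k. \<Sum>a=1..k. if k < a + i then (2 * real i - 1) * \<alpha> a * \<beta> i else 0)
      + (\<Sum>i=1..k. \<Sum>a=1..k. if k < a + i then (2 * real i - 1) * \<alpha> i * \<beta> a else 0)"
  proof -
    have "(2 * real i - 1) * (X i * \<beta> i + Y i * \<alpha> i)
      = (\<Sum>a=1..k. if k < a + i then (2 * real i - 1) * \<alpha> a * \<beta> i else 0)
      + (\<Sum>a=1..k. if k < a + i then (2 * real i - 1) * \<alpha> i * \<beta> a else 0)" if "i \<in> {1..k}" for i
    proof -
      have "X i * \<beta> i = (\<Sum>a=1..k. if k < a + i then \<alpha> a * \<beta> i else 0)"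
        "Y i * \<alpha> i = (\<Sum>a=1..k. if k < a + i then \<alpha> i * \<beta> a else 0)"
        using that by (auto simp: Xsum Ysum sum_distrib_right intro!: sum.cong)
      then show ?thesis
        unfolding distrib_left sum_distrib_left
        by (auto simp: sum_distrib_left intro!: arg_cong2[of _ _ _ _ "(+)"] sum.cong)
    qed
    then show ?thesis by (simp add: sum.distrib)
  qed
  also have "(\<Sum>i=1..k. \<Sum>a=1..k. if k < a + i then (2 * real i - 1) * \<alpha> a * \<beta> i else 0)
      = (\<Sum>a=1..k. \<Sum>b=1..k. if k < a + b then (2 * real b - 1) * \<alpha> a * \<beta> b else 0)"
    by (rule sum.swap)
  also have "(\<Sum>i=1..k. \<Sum>a=1..k. if k < a + i then (2 * real i - 1) * \<alpha> i * \<beta> a else 0)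
      = (\<Sum>a=1..k. \<Sum>b=1..k. if k < a + b then (2 * real a - 1) * \<alpha> a * \<beta> b else 0)"
    by (simp add: add.commute)
  also have "(\<Sum>a=1..k. \<Sum>b=1..k. if k < a + b then (2 * real b - 1) * \<alpha> a * \<beta> b else 0)
      + (\<Sum>a=1..k. \<Sum>b=1..k. if k < a + b then (2 * real a - 1) * \<alpha> a * \<beta> b else 0)
      \<le> (\<Sum>a=1..k. \<Sum>b=1..k. 2 * L a * \<alpha> a * \<beta> b) + (\<Sum>a=1..k. \<Sum>b=1..k. 2 * L b * \<beta> b * \<alpha> a)"
    unfolding sum.distrib[symmetric]
  proof (intro sum_mono)
    fix a b assume ab: "a \<in> {1..k}" "b \<in> {1..k}"
    have p: "\<alpha> a * \<beta> b \<ge> 0" using nonneg ab by simp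
    show "(if k < a + b then (2 * real b - 1) * \<alpha> a * \<beta> b else 0)
        + (if k < a + b then (2 * real a - 1) * \<alpha> a * \<beta> b else 0)
        \<le> 2 * L a * \<alpha> a * \<beta> b + 2 * L b * \<beta> b * \<alpha> a"
    proof (cases "k < a + b")
      case True
      have "real a + real b \<le> L a + L b"
        unfolding L_def using tail_coefficient_bound[OF True] ab by simp
      then have "(2 * real b - 1 + (2 * real a - 1)) * (\<alpha> a * \<beta> b) \<le> (2 * L a + 2 * L b) * (\<alpha> a * \<beta> b)"
        by (intro mult_right_mono p) simp
      then show ?thesis using True by (simp add: algebra_simps)
    next
      case False
      have "0 \<le> (2 * L a + 2 * L b) * (\<alpha> a * \<beta> b)" using p L_nonneg[of a] L_nonneg[of b] by simp
      then show ?thesis using False by (simp add: algebra_simps)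
    qed
  qed
  also have "(\<Sum>a=1..k. \<Sum>b=1..k. 2 * L b * \<beta> b * \<alpha> a) = (\<Sum>b=1..k. \<Sum>a=1..k. 2 * L b * \<beta> b * \<alpha> a)"
    by (rule sum.swap)
  also have "(\<Sum>a=1..k. \<Sum>b=1..k. 2 * L a * \<alpha> a * \<beta> b) + \<dots>
      \<le> (\<Sum>a=1..k. L a * \<alpha> a) + (\<Sum>b=1..k. L b * \<beta> b)"
    using le[of \<alpha> \<beta>] le[of \<beta> \<alpha>] nonneg sums by (intro add_mono) auto
  also have "\<dots> = (\<Sum>i=1..k. f i * (X i + Y i))"
    using linear[OF Xsum] linear[OF Ysum] by (simp add: distrib_left sum.distrib)
  finally show ?thesis by (simp add: \<alpha>_def \<beta>_def f_def)
qed

section \<open>Distance sums around a median\<close>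

text \<open>A step of length \<open>d\<close> from the median to its \<open>i\<close>-th right
  neighbour takes \<open>k + i\<close> agents at most \<open>d\<close> farther away and brings the
  other \<open>k + 1 - i\<close> at least \<open>d\<close> closer. The counts differ by
  \<open>2 * i - 1\<close>.\<close>

lemma sum_dist_at_right:
  assumes xs: "sorted xs" "length xs = 2 * k + 1" "set xs \<subseteq> {xs ! k - 1/2..xs ! k + 1/2}"
    and i: "i \<le> k"
  shows "(\<Sum>j<2 * k + 1. circ_norm (xs ! (k + i) - xs ! j))
    \<le> (\<Sum>j<2 * k + 1. circ_norm (xs ! k - xs ! j)) + (2 * real i - 1) * (xs ! (k + i) - xs ! k)"
proof -
  define d where "d = xs ! (k + i) - xs ! k"
  have mono: "xs ! p \<le> xs ! q" if "p \<le> q" "q < 2 * k + 1" for p q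
    using that xs(1,2) by (simp add: sorted_iff_nth_mono)
  have near: "circ_norm (xs ! k - xs ! j) = \<bar>xs ! k - xs ! j\<bar>" if "j < 2 * k + 1" for j
  proof -
    have "xs ! j \<in> {xs ! k - 1/2..xs ! k + 1/2}"
      by (rule subsetD[OF xs(3)]) (use that xs(2) in simp)
    then have "\<bar>xs ! k - xs ! j\<bar> \<le> 1/2" unfolding atLeastAtMost_iff by linarith
    then show ?thesis by (rule circ_norm_eq_abs)
  qed
  have d: "d \<ge> 0" using mono[of k "k + i"] i by (simp add: d_def)
  have "circ_norm (xs ! (k + i) - xs ! j) \<le> circ_norm (xs ! k - xs ! j) + (if j < k + i then d else - d)"
    if j: "j < 2 * k + 1" for j
  proof (cases "j < k + i")
    case True
    then show ?thesis
      using circ_norm_add_le[of "xs ! k - xs ! j" d] d by (simp add: d_def)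
  next
    case False
    then have "xs ! k \<le> xs ! (k + i)" "xs ! (k + i) \<le> xs ! j" using j by (auto intro: mono)
    then show ?thesis
      using False circ_norm_le_abs[of "xs ! (k + i) - xs ! j"] near[OF j] by (simp add: d_def)
  qed
  then have "(\<Sum>j<2 * k + 1. circ_norm (xs ! (k + i) - xs ! j))
      \<le> (\<Sum>j<2 * k + 1. circ_norm (xs ! k - xs ! j) + (if j < k + i then d else - d))"
    by (intro sum_mono) simp
  also have "\<dots> = (\<Sum>j<2 * k + 1. circ_norm (xs ! k - xs ! j)) + (2 * real i - 1) * d"
  proof -
    have "(\<Sum>j<2 * k + 1. if j < k + i then d else - d) = (2 * real i - 1) * d"
      using i by (subst sum_step_function) (auto simp: of_nat_diff algebra_simps)
    then show ?thesis by (simp only: sum.distrib)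
  qed
  finally show ?thesis by (simp add: d_def)
qed

text \<open>The mirror image: negating and reversing the list turns left neighbours into right
  ones.\<close>

lemma sum_dist_at_left:
  assumes xs: "sorted xs" "length xs = 2 * k + 1" "set xs \<subseteq> {xs ! k - 1/2..xs ! k + 1/2}"
    and i: "i \<le> k"
  shows "(\<Sum>j<2 * k + 1. circ_norm (xs ! (k - i) - xs ! j))
    \<le> (\<Sum>j<2 * k + 1. circ_norm (xs ! k - xs ! j)) + (2 * real i - 1) * (xs ! k - xs ! (k - i))"
proof -
  define ys where "ys = rev (map uminus xs)"
  have ys: "sorted ys" "length ys = 2 * k + 1"
    using xs(1,2) by (simp_all add: ys_def sorted_wrt_rev sorted_wrt_map)
  have nth: "ys ! p = - (xs ! (2 * k - p))" if "p < 2 * k + 1" for p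
    using that xs(2) by (simp add: ys_def rev_nth)
  have flip: "(\<Sum>j<2 * k + 1. circ_norm (- u - ys ! j)) = (\<Sum>j<2 * k + 1. circ_norm (u - xs ! j))" for u
  proof -
    have "(\<Sum>j<2 * k + 1. circ_norm (u - xs ! j)) = (\<Sum>j<2 * k + 1. circ_norm (u - xs ! (2 * k + 1 - Suc j)))"
      by (rule sum.nat_diff_reindex[symmetric])
    also have "\<dots> = (\<Sum>j<2 * k + 1. circ_norm (- u - ys ! j))"
    proof (rule sum.cong)
      fix j assume "j \<in> {..<2 * k + 1}"
      then show "circ_norm (u - xs ! (2 * k + 1 - Suc j)) = circ_norm (- u - ys ! j)"
        using circ_norm_commute[of u "xs ! (2 * k - j)"] by (simp add: nth)
    qed simp
    finally show ?thesis ..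
  qed
  have "set ys \<subseteq> {ys ! k - 1/2..ys ! k + 1/2}"
    using xs(3) by (force simp: ys_def nth[unfolded ys_def])
  then have right: "(\<Sum>j<2 * k + 1. circ_norm (ys ! (k + i) - ys ! j))
    \<le> (\<Sum>j<2 * k + 1. circ_norm (ys ! k - ys ! j)) + (2 * real i - 1) * (ys ! (k + i) - ys ! k)"
    by (rule sum_dist_at_right[OF ys _ i])
  have "ys ! (k + i) = - (xs ! (k - i))" "ys ! k = - (xs ! k)"
    using nth[of "k + i"] nth[of k] i by simp_all
  with right show ?thesis by (simp only: flip) simp
qed

text \<open>Both parts of the mechanism enter without the factor \<open>1/2\<close>, hence
  \<open>7/2\<close> for a ratio of \<open>7/4\<close>. The dictator's bound cancels the term that
  \<open>bilinear_bound\<close> subtracts.\<close>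

lemma median_window_bound:
  fixes xs :: "real list"
  assumes xs: "sorted xs" "length xs = 2 * k + 1" "set xs \<subseteq> {xs ! k - 1/2..xs ! k + 1/2}"
  defines "F \<equiv> \<lambda>x. \<Sum>j<2 * k + 1. circ_norm (x - xs ! j)"
  shows "(\<Sum>j<2 * k + 1. F (xs ! j)) / (2 * real k + 1) + pcd F xs \<le> 7/2 * F (xs ! k)"
proof -
  define z where "z = xs ! k"
  define n where "n = 2 * real k + 1"
  define X where "X i = xs ! (k + i) - z" for i
  define Y where "Y i = z - xs ! (k - i)" for i
  have n: "n > 0" by (simp add: n_def)
  have mono: "xs ! p \<le> xs ! q" if "p \<le> q" "q < 2 * k + 1" for p q
    using that xs(1,2) by (simp add: sorted_iff_nth_mono)
  have bnd: "z - 1/2 \<le> xs ! j" "xs ! j \<le> z + 1/2" if "j < 2 * k + 1" for j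
  proof -
    have "xs ! j \<in> {xs ! k - 1/2..xs ! k + 1/2}"
      by (rule subsetD[OF xs(3)]) (use that xs(2) in simp)
    then show "z - 1/2 \<le> xs ! j" "xs ! j \<le> z + 1/2" by (auto simp: z_def)
  qed
  have X0: "X 0 = 0" "X k \<le> 1/2" and Y0: "Y 0 = 0" "Y k \<le> 1/2"
    using bnd[of "2 * k"] bnd[of 0] by (auto simp: X_def Y_def z_def mult_2)
  have X: "X i \<le> X j" and Y: "Y i \<le> Y j" if "i \<le> j" "j \<le> k" for i j
    using that mono[of "k + i" "k + j"] mono[of "k - j" "k - i"] by (auto simp: X_def Y_def)
  have Fz: "F z = (\<Sum>i=1..k. X i + Y i)"
  proof -
    have "\<bar>z - xs ! j\<bar> \<le> 1/2" if "j < 2 * k + 1" for j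
      using bnd[OF that] by linarith
    then have "F z = (\<Sum>j<2 * k + 1. \<bar>z - xs ! j\<bar>)"
      unfolding F_def by (intro sum.cong circ_norm_eq_abs) simp_all
    also have "\<dots> = (\<Sum>i=1..k. \<bar>z - xs ! (k + i)\<bar> + \<bar>z - xs ! (k - i)\<bar>)"
      unfolding sum_around_middle by (simp add: z_def)
    also have "\<dots> = (\<Sum>i=1..k. X i + Y i)"
      using X[of 0] Y[of 0] X0(1) Y0(1)
      by (intro sum.cong) (auto simp: X_def Y_def)
    finally show ?thesis .
  qed
  \<comment> \<open>Line distances overestimate the dictator's cost, but in sorted order they have a
    closed form whose coefficients at \<open>k + i\<close> and \<open>k - i\<close> are opposite, so
    \<open>z\<close> cancels.\<close>
  have "(\<Sum>p<2 * k + 1. F (xs ! p)) \<le> (\<Sum>p<2 * k + 1. \<Sum>j<2 * k + 1. \<bar>xs ! p - xs ! j\<bar>)"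
    unfolding F_def by (intro sum_mono circ_norm_le_abs)
  also have "\<dots> = 2 * (\<Sum>j<2 * k + 1. (2 * real j + 1 - real (2 * k + 1)) * xs ! j)"
    by (rule sum_abs_diff_sorted) (rule mono)
  also have "\<dots> = 2 * (\<Sum>i=1..k. 2 * real i * (X i + Y i))"
  proof -
    have "(2 * real (k + i) + 1 - real (2 * k + 1)) * xs ! (k + i)
        + (2 * real (k - i) + 1 - real (2 * k + 1)) * xs ! (k - i) = 2 * real i * (X i + Y i)"
      if "i \<in> {1..k}" for i
      using that by (auto simp: X_def Y_def of_nat_diff algebra_simps)
    then show ?thesis unfolding sum_around_middle by simp
  qed
  finally have "(\<Sum>p<2 * k + 1. F (xs ! p)) / n \<le> 2 * (\<Sum>i=1..k. 2 * real i * (X i + Y i)) / n"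
    using n by (intro divide_right_mono) auto
  also have "\<dots> = (\<Sum>i=1..k. 4 * real i / n * (X i + Y i))"
    unfolding sum_distrib_left sum_divide_distrib by (simp add: mult.assoc)
  finally have rd: "(\<Sum>p<2 * k + 1. F (xs ! p)) / n \<le> (\<Sum>i=1..k. 4 * real i / n * (X i + Y i))" .
  \<comment> \<open>One turn later, the arc opposite to a right neighbour joins consecutive entries
    from \<open>z\<close> leftwards; for a left neighbour it joins consecutive entries from
    \<open>z\<close> rightwards.\<close>
  have w_right: "arc_weight xs (k + i) = Y (k + 1 - i) - Y (k - i)"
    and w_left: "arc_weight xs (k - i) = X (k + 1 - i) - X (k - i)" if "i \<in> {1..k}" for i
  proof -
    have "lift xs (k + i + k + 1) = xs ! i + 1" "lift xs (k + i + k) = xs ! (i - 1) + 1"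
      using that xs(2) by (simp_all add: lift_ge)
    then show "arc_weight xs (k + i) = Y (k + 1 - i) - Y (k - i)"
      using that xs(2) by (simp add: arc_weight_def Y_def)
    show "arc_weight xs (k - i) = X (k + 1 - i) - X (k - i)"
    proof -
      have "k - i + k + 1 = k + (k + 1 - i)" "k - i + k = k + (k - i)"
        using that by auto
      moreover have "k + (k + 1 - i) < length xs" "k + (k - i) < length xs"
        using that xs(2) by auto
      ultimately have "lift xs (k - i + k + 1) = xs ! (k + (k + 1 - i))" "lift xs (k - i + k) = xs ! (k + (k - i))"
        by (simp_all only: lift_less)
      then show ?thesis using xs(2) by (simp add: arc_weight_def X_def)
    qed
  qed
  have ne: "xs \<noteq> []" using xs(2) by auto
  have sub: "set xs \<subseteq> {z - 1/2..(z - 1/2) + 1}" using xs(3) by (auto simp: z_def)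
  have nonneg: "arc_weight xs j \<ge> 0" for j
    by (rule arc_weight_nonneg[OF xs(1) ne sub])
  have "pcd F xs - F z = (\<Sum>j<2 * k + 1. arc_weight xs j * (F (xs ! j) - F z))"
    using sum_arc_weight[OF ne] xs(2)
    by (simp add: pcd_def right_diff_distrib sum_subtractf flip: sum_distrib_right)
  also have "\<dots> = (\<Sum>i=1..k. arc_weight xs (k + i) * (F (xs ! (k + i)) - F z)
      + arc_weight xs (k - i) * (F (xs ! (k - i)) - F z))"
    unfolding sum_around_middle by (simp add: z_def)
  also have "\<dots> \<le> (\<Sum>i=1..k. arc_weight xs (k + i) * ((2 * real i - 1) * X i)
      + arc_weight xs (k - i) * ((2 * real i - 1) * Y i))"
  proof (intro sum_mono add_mono mult_left_mono nonneg)
    fix i assume "i \<in> {1..k}"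
    then show "F (xs ! (k + i)) - F z \<le> (2 * real i - 1) * X i"
      "F (xs ! (k - i)) - F z \<le> (2 * real i - 1) * Y i"
      using sum_dist_at_right[OF xs, of i] sum_dist_at_left[OF xs, of i]
      unfolding F_def X_def Y_def z_def by auto
  qed
  also have "\<dots> = (\<Sum>i=1..k. (2 * real i - 1) *
      (X i * (Y (k + 1 - i) - Y (k - i)) + Y i * (X (k + 1 - i) - X (k - i))))"
    by (intro sum.cong refl) (simp only: w_left w_right, simp add: algebra_simps)
  also have "\<dots> \<le> (\<Sum>i=1..k. (5/2 - 4 * real i / n) * (X i + Y i))"
    unfolding n_def by (rule bilinear_bound[OF X0(1) X X0(2) Y0(1) Y Y0(2)])
  also have "\<dots> = 5/2 * F z - (\<Sum>i=1..k. 4 * real i / n * (X i + Y i))"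
    unfolding Fz by (simp only: left_diff_distrib sum_subtractf sum_distrib_left)
  finally have excess: "pcd F xs - F z \<le> 5/2 * F z - (\<Sum>i=1..k. 4 * real i / n * (X i + Y i))" .
  have "r + p \<le> 7/2 * f" if "p - f \<le> 5/2 * f - q" "r \<le> q" for f p q r :: real
    using that by simp
  from this[OF excess rd] show ?thesis unfolding n_def z_def .
qed

section \<open>Optimal locations and the social cost of the mechanism\<close>

definition dist_sum :: "('n::finite \<Rightarrow> cycle) \<Rightarrow> real \<Rightarrow> real" where
  "dist_sum b x = (\<Sum>i\<in>UNIV. circ_norm (x - coord (b i)))"

lemma periodic1_dist_sum: "periodic1 (dist_sum b)"
  unfolding periodic1_def dist_sum_def
  using periodic1_circ_norm[unfolded periodic1_def] by (blast intro: sum.cong)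

lemma dist_sum_window:
  fixes b :: "'n::finite \<Rightarrow> cycle"
  shows "dist_sum b x = (\<Sum>j<CARD('n). circ_norm (x - window a b ! j))"
  unfolding dist_sum_def circ_norm_commute[of x]
  by (rule sum_window[OF periodic1_circ_norm, symmetric])

text \<open>Cutting at the antipode of \<open>c\<close> makes line and circle distances from
  \<open>c\<close> agree. From \<open>m\<close> the line distances can only be larger, and the
  median minimises their sum. The gain \<open>|c - m|\<close> is the summand of the middle agent,
  which is zero at \<open>m\<close>.\<close>

lemma window_median_improves:
  fixes b :: "'n::finite \<Rightarrow> cycle" and c :: real
  assumes k: "CARD('n) = 2 * k + 1"
  defines "m \<equiv> window (c - 1/2) b ! k"
  shows "dist_sum b m + \<bar>c - m\<bar> \<le> dist_sum b c"
proof -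
  define xs where "xs = window (c - 1/2) b"
  have mono: "xs ! p \<le> xs ! q" if "p \<le> q" "q < 2 * k + 1" for p q
    using that k sorted_window[of "c - 1/2" b] by (simp add: xs_def sorted_iff_nth_mono)
  have near: "\<bar>c - xs ! j\<bar> \<le> 1/2" if "j < 2 * k + 1" for j
  proof -
    have "xs ! j \<in> set xs" using that k by (simp add: xs_def)
    then have "c - 1/2 \<le> xs ! j \<and> xs ! j < c - 1/2 + 1" unfolding xs_def by (rule window_bounds)
    then show ?thesis by linarith
  qed
  have "dist_sum b m \<le> (\<Sum>j<2 * k + 1. \<bar>m - xs ! j\<bar>)"
    unfolding dist_sum_window[of b m "c - 1/2"] k xs_def by (intro sum_mono circ_norm_le_abs)
  also have "\<dots> = (\<Sum>i=1..k. \<bar>m - xs ! (k + i)\<bar> + \<bar>m - xs ! (k - i)\<bar>)"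
    unfolding sum_around_middle by (simp add: m_def xs_def)
  also have "\<dots> \<le> (\<Sum>i=1..k. \<bar>c - xs ! (k + i)\<bar> + \<bar>c - xs ! (k - i)\<bar>)"
  proof (rule sum_mono)
    fix i assume "i \<in> {1..k}"
    then have "xs ! (k - i) \<le> m" "m \<le> xs ! (k + i)"
      using mono[of "k - i" k] mono[of k "k + i"] by (auto simp: m_def xs_def)
    then show "\<bar>m - xs ! (k + i)\<bar> + \<bar>m - xs ! (k - i)\<bar> \<le> \<bar>c - xs ! (k + i)\<bar> + \<bar>c - xs ! (k - i)\<bar>"
      by linarith
  qed
  also have "\<dots> = (\<Sum>j<2 * k + 1. \<bar>c - xs ! j\<bar>) - \<bar>c - m\<bar>"
    unfolding sum_around_middle by (simp add: m_def xs_def)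
  also have "(\<Sum>j<2 * k + 1. \<bar>c - xs ! j\<bar>) = dist_sum b c"
    unfolding dist_sum_window[of b c "c - 1/2"] k xs_def[symmetric]
    using near by (intro sum.cong circ_norm_eq_abs[symmetric]) auto
  finally show ?thesis by simp
qed

lemma social_cost_return: "social_cost b (return_pmf v) = dist_sum b (coord v)"
  by (simp add: social_cost_def cost_def dist_sum_def cdist_circ_norm)

lemma social_cost_mechanism:
  fixes b :: "'n::finite \<Rightarrow> cycle"
  shows "social_cost b (mechanism b)
    = ((\<Sum>i\<in>UNIV. dist_sum b (coord (b i))) / real CARD('n) + pcd (dist_sum b) (window (-1/2) b)) / 2"
proof -
  have "(\<Sum>i\<in>UNIV. pcd (\<lambda>x. circ_norm (x - coord (b i))) xs) = pcd (dist_sum b) xs" for xs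
    unfolding pcd_def dist_sum_def by (subst sum.swap) (simp add: sum_distrib_left)
  moreover have "(\<Sum>i\<in>UNIV. \<Sum>j\<in>UNIV. circ_norm (coord (b j) - coord (b i)))
      = (\<Sum>i\<in>UNIV. dist_sum b (coord (b i)))"
    unfolding dist_sum_def by (rule sum.swap)
  ultimately show ?thesis
    unfolding social_cost_def cost_mechanism
    by (simp add: sum.distrib flip: sum_divide_distrib)
qed

lemma social_cost_mechanism_le:
  fixes b :: "'n::finite \<Rightarrow> cycle"
  assumes "odd CARD('n)"
  shows "social_cost b (mechanism b) \<le> 7/4 * opt_cost b"
proof -
  obtain k where k: "CARD('n) = 2 * k + 1" using assms by (auto elim: oddE)
  \<comment> \<open>The best agent suffices: every window median is an agent up to full turns, so
    none beats \<open>z\<close>, and each point of the circle is matched by some median.\<close>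
  define z where "z = coord (b (arg_min (\<lambda>i. dist_sum b (coord (b i))) (\<lambda>_. True)))"
  have z_min: "dist_sum b z \<le> dist_sum b (coord (b i))" for i
    using arg_min_least[of UNIV i "\<lambda>i. dist_sum b (coord (b i))"]
    by (simp add: z_def arg_min_on_def)
  have median_le: "dist_sum b z \<le> dist_sum b (window a b ! k)" for a
  proof -
    have "window a b ! k \<in> set (window a b)" using k by simp
    then obtain i where "window a b ! k = a + frac (coord (b i) - a)"
      by (auto simp: set_window)
    then have "window a b ! k = coord (b i) + of_int (- \<lfloor>coord (b i) - a\<rfloor>)"
      by (simp add: frac_def)
    then show ?thesis
      using z_min[of i] periodic1_add_int[OF periodic1_dist_sum] by metis
  qed
  have opt: "dist_sum b z \<le> opt_cost b"
    unfolding opt_cost_def social_cost_return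
  proof (rule cINF_greatest)
    fix v
    show "dist_sum b z \<le> dist_sum b (coord v)"
      using median_le[of "coord v - 1/2"] window_median_improves[OF k, of b "coord v"] by linarith
  qed simp
  define xs where "xs = window (z - 1/2) b"
  \<comment> \<open>No median beats \<open>z\<close>, so the gain in
    \<open>window_median_improves\<close> must vanish and \<open>z\<close> is the median of its own
    window.\<close>
  have xsk: "xs ! k = z"
    using median_le[of "z - 1/2"] window_median_improves[OF k, of b z] by (simp add: xs_def)
  have len: "length xs = 2 * k + 1" using k by (simp add: xs_def)
  have sub: "set xs \<subseteq> {xs ! k - 1/2..xs ! k + 1/2}"
    unfolding xsk using window_bounds[of _ "z - 1/2" b] by (fastforce simp: xs_def)
  have F: "dist_sum b = (\<lambda>x. \<Sum>j<2 * k + 1. circ_norm (x - xs ! j))"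
    unfolding xs_def dist_sum_window[of b _ "z - 1/2", abs_def] k ..
  have "(\<Sum>j<2 * k + 1. dist_sum b (xs ! j)) / (2 * real k + 1) + pcd (dist_sum b) xs \<le> 7/2 * dist_sum b z"
  proof -
    have "sorted xs" by (simp add: xs_def)
    from median_window_bound[OF this len sub] show ?thesis unfolding F xsk .
  qed
  moreover have "(\<Sum>j<2 * k + 1. dist_sum b (xs ! j)) = (\<Sum>i\<in>UNIV. dist_sum b (coord (b i)))"
    using sum_window[OF periodic1_dist_sum[of b], of "z - 1/2" b] by (simp only: k xs_def)
  moreover have "pcd (dist_sum b) xs = pcd (dist_sum b) (window (-1/2) b)"
  proof -
    have "-1/2 \<le> z" "z < 1/2" unfolding z_def using coord by auto
    then show ?thesis
      using pcd_window_shift[OF periodic1_dist_sum[of b], of "z - 1/2" "-1/2" b]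
        pcd_window_shift[OF periodic1_dist_sum[of b], of "-1/2" "z - 1/2" b]
      by (cases "z \<le> 0") (simp_all add: xs_def)
  qed
  moreover have "real CARD('n) = 2 * real k + 1" using k by simp
  ultimately have "(\<Sum>i\<in>UNIV. dist_sum b (coord (b i))) / real CARD('n) + pcd (dist_sum b) (window (-1/2) b)
      \<le> 7/2 * dist_sum b z"
    by (simp only:)
  also have "\<dots> \<le> 7/2 * opt_cost b" using opt by simp
  finally have twice: "(\<Sum>i\<in>UNIV. dist_sum b (coord (b i))) / real CARD('n)
      + pcd (dist_sum b) (window (-1/2) b) \<le> 7/2 * opt_cost b" .
  have "s / 2 \<le> 7/4 * w" if "s \<le> 7/2 * w" for s w :: real
    using that by simp
  from this[OF twice] show ?thesis unfolding social_cost_mechanism .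
qed

theorem theorem1:
  assumes "odd CARD('n::finite)" and "CARD('n) \<ge> 3"
  shows "\<exists>M :: ('n \<Rightarrow> cycle) \<Rightarrow> cycle pmf.
           strategyproof M \<and> (\<forall>b. social_cost b (M b) \<le> 7 / 4 * opt_cost b)"
  using strategyproof_mechanism[OF assms] social_cost_mechanism_le[OF assms(1)] by blast

end
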